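(* Let $p_0,p_1>0$ with $p_0+p_1=1$ and $p_0\neq p_1$, let $\Omega=\{0,1\}^{\mathbb{N}}$, and let $\mathbb{P}$ be the product probability on $\Omega$ under which the coordinates $\omega_j$ are i.i.d. with $\mathbb{P}\{\omega_0=0\}=p_0$ and $\mathbb{P}\{\omega_0=1\}=p_1$. Let $S:\Omega\to\Omega$ be given by $(S\omega)_n=\omega_n+\omega_{n+1}\pmod 2$ for $n\geq 0$, and let $\mathbb{P}_0$ be the image measure $\mathbb{P}_0(U)=\mathbb{P}(S^{-1}U)$. Then $\mathbb{P}_0$ is invariant under the left shift $T$, and its $\psi$-mixing coefficients satisfy $\psi_0<\infty$ and $\psi_l=0$ for all $l\ge1$. Moreover, let $A_n=\{\omega\in\Omega:\omega_0=\dots=\omega_{n-1}=1\}$, let $t>0$, and put $$N_n=[t(\mathbb{P}_0(A_n))^{-1}],\qquad U_n=\sum_{k=1}^{N_n}\mathbb{I}_{A_n}\circ T^k.$$ Then the sequence $U_n$, $n\ge1$, considered as random variables on $(\Omega,\mathbb{P}_0)$, does not converge in distribution as $n\to\infty$.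
   Context: $\mathbb{N}=\{0,1,2,\dots\}$; $[x]$ is the integral part of a number $x$; $T$ is the left shift $(T\omega)_i=\omega_{i+1}$; $\mathbb{I}_A$ is the indicator of $A$. $\Omega$ carries the $\sigma$-algebra generated by cylinder sets. For $0\le k\le n\le\infty$, $\mathcal{F}_{k,n}$ is the $\sigma$-algebra generated by the coordinates $\omega_i$ with $k\le i\le n$ (all $i\ge k$ if $n=\infty$). The $\psi$-mixing coefficients of $\mathbb{P}_0$ are $$\psi_m=\sup_{n\in\mathbb{N}}\ \sup\Big\{\Big|\frac{\mathbb{P}_0(B\cap C)}{\mathbb{P}_0(B)\mathbb{P}_0(C)}-1\Big|:B\in\mathcal{F}_{0,n},\ C\in\mathcal{F}_{n+m+1,\infty},\ \mathbb{P}_0(B)\mathbb{P}_0(C)\ne0\Big\}.$$ *)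

theory Defs
  imports "HOL-Probability.Probability" "HOL-Library.Z2"
begin

text \<open>The alphabet \<open>{0,1}\<close> is the type \<open>bit\<close>, whose addition is addition modulo 2, so that
  \<open>\<Omega>\<close> is the whole type \<open>nat \<Rightarrow> bit\<close>.\<close>

type_synonym binseq = "nat \<Rightarrow> bit"

text \<open>Parameter: the probability of the letter 1 (the letter 0 has the complementary weight).\<close>

definition coin_pmf :: "real \<Rightarrow> bit pmf" where
  "coin_pmf p1 = map_pmf of_bool (bernoulli_pmf p1)"

definition iid_measure :: "real \<Rightarrow> binseq measure" where
  "iid_measure p1 = PiM UNIV (\<lambda>_. measure_pmf (coin_pmf p1))"

definition left_shift :: "binseq \<Rightarrow> binseq" where
  "left_shift \<omega> = (\<lambda>i. \<omega> (i + 1))"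

definition xor_map :: "binseq \<Rightarrow> binseq" where
  "xor_map \<omega> = (\<lambda>n. \<omega> n + \<omega> (n + 1))"

definition image_measure :: "real \<Rightarrow> binseq measure" where
  "image_measure p1 = distr (iid_measure p1) (iid_measure p1) xor_map"

definition coord_algebra :: "nat \<Rightarrow> enat \<Rightarrow> binseq set set" where
  "coord_algebra k n =
     sigma_sets UNIV {(\<lambda>\<omega>. \<omega> i) -` A | i A. k \<le> i \<and> enat i \<le> n}"

text \<open>The coefficients take values in \<open>ereal\<close>, since the supremum may be infinite.\<close>

definition psi_mixing :: "binseq measure \<Rightarrow> nat \<Rightarrow> ereal" where
  "psi_mixing M m =
     (SUP n::nat. Sup {ereal \<bar>measure M (B \<inter> C) / (measure M B * measure M C) - 1\<bar> | B C.
        B \<in> coord_algebra 0 (enat n) \<and> C \<in> coord_algebra (n + m + 1) \<infinity> \<and>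
        measure M B * measure M C \<noteq> 0})"

definition ones_cylinder :: "nat \<Rightarrow> binseq set" where
  "ones_cylinder n = {\<omega>. \<forall>i<n. \<omega> i = 1}"

definition visit_horizon :: "binseq measure \<Rightarrow> real \<Rightarrow> nat \<Rightarrow> nat" where
  "visit_horizon M t n = nat \<lfloor>t * inverse (measure M (ones_cylinder n))\<rfloor>"

definition visit_count :: "binseq measure \<Rightarrow> real \<Rightarrow> nat \<Rightarrow> binseq \<Rightarrow> real" where
  "visit_count M t n \<omega> =
     (\<Sum>k = 1..visit_horizon M t n. indicator (ones_cylinder n) ((left_shift ^^ k) \<omega>))"

definition converges_in_distribution :: "'a measure \<Rightarrow> (nat \<Rightarrow> 'a \<Rightarrow> real) \<Rightarrow> bool" where
  "converges_in_distribution M X \<longleftrightarrow>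
     (\<exists>\<mu>. real_distribution \<mu> \<and> weak_conv_m (\<lambda>n. distr M borel (X n)) \<mu>)"

end

theory Submission
  imports Defs "HOL-Real_Asymp.Real_Asymp"
begin

text \<open>A visit to \<open>A\<^sub>n\<close> at \<open>k\<close> is an alternating word of length \<open>n + 1\<close> starting at \<open>k\<close> in the i.i.d.
  sequence. A failure \<open>\<omega>\<^sub>j = \<omega>\<^sub>j\<^sub>+\<^sub>1\<close> of the alternation excludes all visits across it, so visits
  come in clumps, and the probability of no visit among \<open>m\<close> consecutive positions is
  asymptotically \<open>(1 - \<delta>)\<^sup>m\<close>, where \<open>\<delta> = \<bbbP>\<^sub>0(A\<^sub>n) - \<bbbP>\<^sub>0(A\<^sub>n\<^sub>+\<^sub>1)\<close> is the probability that a
  clump ends at a given position. With \<open>q = p\<^sub>0 p\<^sub>1\<close> one has \<open>\<bbbP>\<^sub>0(A\<^sub>2\<^sub>k) = q\<^sup>k\<close> and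
  \<open>\<bbbP>\<^sub>0(A\<^sub>2\<^sub>k\<^sub>+\<^sub>1) = 2 q\<^sup>k\<^sup>+\<^sup>1\<close>, so that the probability of the event \<open>U\<^sub>n = 0\<close> tends to
  \<open>exp (- t (1 - 2 q))\<close> along even \<open>n\<close> and to \<open>exp (- t / 2)\<close> along odd \<open>n\<close>; the limits agree only
  if \<open>q = 1/4\<close>, that is, \<open>p\<^sub>0 = p\<^sub>1\<close>.\<close>

section \<open>Events that depend on a given set of coordinates\<close>

text \<open>A pointwise condition, kept apart from measurability: paired with membership in
  \<open>events\<close> it stands in for membership in a coordinate \<sigma>-algebra, and it passes
  easily through \<open>xor_map\<close> and changes of single letters.\<close>

definition determined_by :: "nat set \<Rightarrow> binseq set \<Rightarrow> bool" where
  "determined_by J B \<longleftrightarrow> (\<forall>\<omega> \<omega>'. (\<forall>i\<in>J. \<omega> i = \<omega>' i) \<longrightarrow> (\<omega> \<in> B \<longleftrightarrow> \<omega>' \<in> B))"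

lemma determined_byD: "determined_by J B \<Longrightarrow> (\<And>i. i \<in> J \<Longrightarrow> \<omega> i = \<omega>' i) \<Longrightarrow> \<omega> \<in> B \<longleftrightarrow> \<omega>' \<in> B"
  by (auto simp: determined_by_def)

lemma determined_by_mono: "determined_by J B \<Longrightarrow> J \<subseteq> K \<Longrightarrow> determined_by K B"
  unfolding determined_by_def by blast

text \<open>The sets determined by fixed coordinates contain the generators and are closed under
  complements and countable unions, so induction over \<open>sigma_sets\<close> applies.\<close>

lemma determined_by_coord_algebra:
  assumes "B \<in> coord_algebra k n"
  shows "determined_by {i. k \<le> i \<and> enat i \<le> n} B"
  using assms unfolding coord_algebra_def
  by (induction rule: sigma_sets.induct) (auto simp: determined_by_def; metis)+

text \<open>Coordinate \<open>n\<close> of the image reads the letters \<open>n\<close> and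
  \<open>n + 1\<close>; hence the successors of \<open>J\<close>.\<close>

lemma determined_by_xor_map:
  assumes "determined_by J B"
  shows "determined_by (J \<union> Suc ` J) (xor_map -` B)"
  unfolding determined_by_def vimage_eq
  by (intro allI impI determined_byD[OF assms]) (auto simp: xor_map_def)

lemma bit_add_eq_1_iff: "x + y = 1 \<longleftrightarrow> x \<noteq> y" for x y :: bit
  by (cases x; cases y) simp_all

subsection \<open>Alternating words\<close>

text \<open>\<open>n\<close> counts comparisons of neighbours, so the word has \<open>n + 1\<close>
  letters and occupies the positions \<open>k\<close> to \<open>k + n\<close>.\<close>

definition alternates :: "nat \<Rightarrow> nat \<Rightarrow> binseq \<Rightarrow> bool" where
  "alternates n k \<omega> \<longleftrightarrow> (\<forall>i<n. \<omega> (k + i) \<noteq> \<omega> (k + i + 1))"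

lemma funpow_left_shift: "(left_shift ^^ k) \<omega> = (\<lambda>i. \<omega> (i + k))"
  by (induction k) (auto simp: left_shift_def)

lemma vimage_ones_cylinder: "xor_map -` ones_cylinder n = {\<omega>. alternates n 0 \<omega>}"
  by (simp only: ones_cylinder_def alternates_def xor_map_def bit_add_eq_1_iff vimage_Collect_eq add_0)

lemma alternates_shift: "alternates n k (\<lambda>i. \<omega> (i + m)) \<longleftrightarrow> alternates n (k + m) \<omega>"
  by (simp add: alternates_def add.commute add.left_commute)

lemma alternates_cong:
  "(\<And>i. k \<le> i \<Longrightarrow> i \<le> k + n \<Longrightarrow> \<omega> i = \<omega>' i) \<Longrightarrow> alternates n k \<omega> \<longleftrightarrow> alternates n k \<omega>'"
  by (simp add: alternates_def)

lemma alternates_Suc: "alternates (Suc n) k \<omega> \<longleftrightarrow> alternates n k \<omega> \<and> \<omega> (k + n) \<noteq> \<omega> (k + n + 1)"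
  by (auto simp: alternates_def less_Suc_eq)

lemma alternates_Suc_front:
  "alternates (Suc n) k \<omega> \<longleftrightarrow> \<omega> k \<noteq> \<omega> (Suc k) \<and> alternates n (Suc k) \<omega>"
  by (auto simp: alternates_def less_Suc_eq_0_disj)

lemma not_alternates_across:
  assumes "\<omega> m = \<omega> (m + 1)" "j \<le> m" "m < j + n"
  shows "\<not> alternates n j \<omega>"
proof -
  have "\<omega> (j + (m - j)) = \<omega> (j + (m - j) + 1)" "m - j < n"
    using assms by auto
  then show ?thesis
    unfolding alternates_def by blast
qed

text \<open>After a visit at 0, either the alternation continues across \<open>n\<close> and there
  is a visit at 1, or it breaks there and the break excludes all visits at 1 to \<open>n\<close>.
  With \<open>m \<ge> 1\<close>, position 1 is among those tested.\<close>

lemma no_alternates_from_1: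
  assumes "n \<ge> 1" "m \<ge> 1" "alternates n 0 \<omega>"
  shows "(\<forall>j\<in>{1..m}. \<not> alternates n j \<omega>) \<longleftrightarrow>
    \<omega> n = \<omega> (n + 1) \<and> (\<forall>j\<in>{n + 1..m}. \<not> alternates n j \<omega>)"
proof -
  have "alternates n 1 \<omega>" if "\<omega> n \<noteq> \<omega> (n + 1)"
    using assms(3) that alternates_Suc[of n 0 \<omega>] alternates_Suc_front[of n 0 \<omega>] by simp
  then show ?thesis
  proof (intro iffI conjI ballI)
    assume L: "\<forall>j\<in>{1..m}. \<not> alternates n j \<omega>"
    then show "\<omega> n = \<omega> (n + 1)"
      using assms(2) \<open>\<omega> n \<noteq> \<omega> (n + 1) \<Longrightarrow> alternates n 1 \<omega>\<close> by auto
    show "\<not> alternates n j \<omega>" if "j \<in> {n + 1..m}" for j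
      using L that by simp
  next
    fix j
    assume "\<omega> n = \<omega> (n + 1) \<and> (\<forall>j\<in>{n + 1..m}. \<not> alternates n j \<omega>)" "j \<in> {1..m}"
    then show "\<not> alternates n j \<omega>"
      using not_alternates_across[of \<omega> n j n] by (cases "j \<le> n") auto
  qed
qed

lemma xor_shift: "xor_map (\<lambda>i. \<omega> (i + k)) = (\<lambda>i. xor_map \<omega> (i + k))"
  by (simp add: xor_map_def add.commute add.left_commute)

text \<open>\<open>xor_map\<close> commutes with shifts, so visits of the image sequence can be read
  off the i.i.d. sequence.\<close>

lemma visit_count_xor:
  "visit_count M t n (xor_map \<omega>) =
    real (card {k\<in>{1..visit_horizon M t n}. alternates n k \<omega>})"
proof -
  have "indicator (ones_cylinder n) ((left_shift ^^ k) (xor_map \<omega>)) = (if alternates n k \<omega> then 1 else 0::real)" for k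
  proof -
    have "(left_shift ^^ k) (xor_map \<omega>) \<in> ones_cylinder n \<longleftrightarrow> (\<lambda>i. \<omega> (i + k)) \<in> xor_map -` ones_cylinder n"
      by (simp add: funpow_left_shift xor_shift)
    then show ?thesis
      unfolding vimage_ones_cylinder by (simp add: indicator_def alternates_shift)
  qed
  then show ?thesis
    unfolding visit_count_def by (simp add: sum.If_cases Int_def)
qed

subsection \<open>The coin-tossing space\<close>

locale coin =
  fixes p :: real
  assumes p: "0 < p" "p < 1"
begin

abbreviation "P \<equiv> iid_measure p"

definition weight :: "bit \<Rightarrow> real" where "weight a = (if a = 1 then p else 1 - p)"

sublocale iid: sequence_space "measure_pmf (coin_pmf p)"
  by unfold_locales

lemma P_eq: "P = PiM UNIV (\<lambda>_. measure_pmf (coin_pmf p))"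
  by (simp add: iid_measure_def)

sublocale prob_space P
  unfolding P_eq by (rule iid.prob_space_axioms)

lemma space_P [simp]: "space P = UNIV"
  by (simp add: P_eq space_PiM)

lemma weight_pos: "weight a > 0"
  using p by (simp add: weight_def)

lemma coord_set: "{\<omega>. \<omega> i \<in> A} \<in> events"
proof -
  have "(\<lambda>\<omega>. \<omega> i) -` A \<inter> space P \<in> events"
    by (rule measurable_sets[where A="measure_pmf (coin_pmf p)"]) (auto simp: P_eq)
  then show ?thesis by (simp add: vimage_def)
qed

lemma coord_eq_set [simp]: "{\<omega>. \<omega> i = a} \<in> events"
  using coord_set[of i "{a}"] by simp

lemma prob_coord: "prob {\<omega>. \<omega> i = a} = weight a"
proof -
  have "prob {\<omega>. \<omega> i = a} = measure (distr P (measure_pmf (coin_pmf p)) (\<lambda>\<omega>. \<omega> i)) {a}"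
    by (subst measure_distr) (auto simp: P_eq space_PiM intro!: arg_cong2[where f=measure])
  also have "distr P (measure_pmf (coin_pmf p)) (\<lambda>\<omega>. \<omega> i) = measure_pmf (coin_pmf p)"
    unfolding P_eq by (rule iid.PiM_component) simp
  also have "measure (measure_pmf (coin_pmf p)) {a} = weight a"
  proof (cases a)
    case zero
    have "of_bool -` {0::bit} = {False}" by auto
    then show ?thesis using p zero
      by (simp add: coin_pmf_def pmf_map measure_pmf_single weight_def)
  next
    case one
    have "of_bool -` {1::bit} = {True}" by auto
    then show ?thesis using p one
      by (simp add: coin_pmf_def pmf_map measure_pmf_single weight_def)
  qed
  finally show ?thesis .
qed

text \<open>The alphabet is finite, so preimages of single letters suffice in each
  coordinate.\<close>

lemma measurable_to_P:
  assumes "\<And>i a. {x \<in> space N. f x i = a} \<in> sets N"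
  shows "f \<in> measurable N P"
  unfolding P_eq
proof (rule measurable_PiM_single')
  fix i
  show "(\<lambda>x. f x i) \<in> measurable N (measure_pmf (coin_pmf p))"
  proof (rule measurableI)
    fix A :: "bit set"
    have "(\<lambda>x. f x i) -` A \<inter> space N = (\<Union>a\<in>A. {x \<in> space N. f x i = a})" by auto
    also have "\<dots> \<in> sets N"
    proof (rule sets.finite_UN)
      show "finite A"
        by (rule finite_subset[of _ "{0,1}"]) auto
    qed (rule assms)
    finally show "(\<lambda>x. f x i) -` A \<inter> space N \<in> sets N" .
  qed simp
qed auto

section \<open>Shift invariance and independence of disjoint blocks\<close>

lemma measurable_shift: "(\<lambda>\<omega> i. \<omega> (i + k)) \<in> measurable P P"
  by (rule measurable_to_P) simp

lemma events_shift: "B \<in> events \<Longrightarrow> {\<omega>. (\<lambda>i. \<omega> (i + k)) \<in> B} \<in> events"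
  using measurable_sets[OF measurable_shift, of B k] by (simp add: vimage_def)

text \<open>\<open>P\<close> is the image of \<open>P \<Otimes>\<^sub>M P\<close> under
  \<open>comb_seq m\<close>, which takes the first \<open>m\<close> letters from one sequence and
  continues with another; the event pulls back to the rectangle \<open>B \<times> C\<close>.\<close>

lemma prob_split:
  assumes "B \<in> events" "C \<in> events" "determined_by {..<m} B"
  shows "prob {\<omega>. \<omega> \<in> B \<and> (\<lambda>i. \<omega> (i + m)) \<in> C} = prob B * prob C"
proof -
  let ?f = "\<lambda>(\<omega>, \<omega>'). comb_seq m \<omega> \<omega>'" and ?D = "{\<omega>. \<omega> \<in> B \<and> (\<lambda>i. \<omega> (i + m)) \<in> C}"
  have f: "?f \<in> measurable (P \<Otimes>\<^sub>M P) P"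
    unfolding P_eq by (rule measurable_comb_seq)
  have D: "?D \<in> events"
    using sets.Int[OF assms(1) events_shift[OF assms(2), of m]] by (simp add: Collect_conj_eq)
  have "comb_seq m \<omega> \<omega>' \<in> B \<longleftrightarrow> \<omega> \<in> B" for \<omega> \<omega>'
    by (rule determined_byD[OF assms(3)]) (simp add: comb_seq_less)
  then have vi: "?f -` ?D \<inter> space (P \<Otimes>\<^sub>M P) = B \<times> C"
    by (auto simp: comb_seq_add space_pair_measure)
  have "emeasure P ?D = emeasure (distr (P \<Otimes>\<^sub>M P) P ?f) ?D"
    using iid.PiM_comb_seq[of m] by (simp flip: P_eq)
  also have "\<dots> = emeasure (P \<Otimes>\<^sub>M P) (B \<times> C)"
    unfolding emeasure_distr[OF f D] vi ..
  also have "\<dots> = emeasure P B * emeasure P C"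
    by (rule emeasure_pair_measure_Times) (use assms in auto)
  finally show ?thesis
    by (simp add: measure_def enn2real_mult)
qed

lemma prob_shift:
  assumes "B \<in> events"
  shows "prob {\<omega>. (\<lambda>i. \<omega> (i + k)) \<in> B} = prob B"
  using prob_split[of UNIV B k] assms prob_space sets.top[of P] by (simp add: determined_by_def)

text \<open>An event on the coordinates from \<open>m\<close> on is the pullback, under the shift by
  \<open>m\<close>, of an event on whole sequences; so \<open>prob_split\<close> and shift
  invariance apply.\<close>

lemma prob_indep:
  assumes "B \<in> events" "C \<in> events" "determined_by {..<m} B" "determined_by {m..} C"
  shows "prob (B \<inter> C) = prob B * prob C"
proof -
  \<comment> \<open>The filler 0 is harmless: \<open>C\<close> ignores the positions below
    \<open>m\<close>, so shifting by \<open>m\<close> and then applying \<open>?s\<close> does not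
    affect membership in \<open>C\<close>.\<close>
  let ?s = "\<lambda>\<omega> i. if i < m then 0 else \<omega> (i - m) :: bit"
  have "?s \<in> measurable P P"
  proof (rule measurable_to_P)
    show "{\<omega> \<in> space P. ?s \<omega> i = a} \<in> events" for i a
      by (cases "i < m"; cases "a = 0") (simp_all add: sets.top[of P, simplified])
  qed
  from measurable_sets[OF this assms(2)] have C0: "{\<omega>. ?s \<omega> \<in> C} \<in> events"
    by (simp add: vimage_def)
  have eq: "(\<lambda>i. \<omega> (i + m)) \<in> {\<omega>. ?s \<omega> \<in> C} \<longleftrightarrow> \<omega> \<in> C" for \<omega>
    unfolding mem_Collect_eq by (rule determined_byD[OF assms(4)]) simp
  have "prob {\<omega>. ?s \<omega> \<in> C} = prob C"
    using prob_shift[OF C0, of m] unfolding eq by simp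
  with prob_split[OF assms(1) C0 assms(3)] show ?thesis
    unfolding eq by (simp add: Int_def)
qed


lemma alternates_set [simp]: "{\<omega>. alternates n k \<omega>} \<in> events"
proof (induction n)
  case 0
  then show ?case by (simp add: alternates_def sets.top[of P, simplified])
next
  case (Suc n)
  have "{\<omega>. \<omega> (k + n) \<noteq> \<omega> (k + n + 1)} =
      (\<Union>a. {\<omega>. \<omega> (k + n) = a} - {\<omega>. \<omega> (k + n + 1) = a})"
    by auto
  also have "\<dots> \<in> events"
  proof (rule sets.finite_UN)
    show "finite (UNIV :: bit set)"
      by (rule finite_subset[of _ "{0,1}"]) auto
  qed (intro sets.Diff coord_eq_set)
  finally have "{\<omega>. \<omega> (k + n) \<noteq> \<omega> (k + n + 1)} \<in> events" .
  from sets.Int[OF Suc this] show ?case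
    unfolding alternates_Suc Collect_conj_eq .
qed

subsection \<open>Probabilities of alternating words\<close>

definition alternating_prob :: "nat \<Rightarrow> real" where
  "alternating_prob n = prob {\<omega>. alternates n 0 \<omega>}"

lemma prob_alternates: "prob {\<omega>. alternates n k \<omega>} = alternating_prob n"
  using prob_shift[OF alternates_set[of n 0], of k]
  by (simp add: alternates_shift alternating_prob_def)

text \<open>Fixing the first letter fixes the whole alternating word and makes a recursion in
  \<open>n\<close> possible.\<close>

definition letter_alternating_prob :: "bit \<Rightarrow> nat \<Rightarrow> real" where
  "letter_alternating_prob a n = prob {\<omega>. \<omega> 0 = a \<and> alternates n 0 \<omega>}"

lemma letter_alternating_prob_0: "letter_alternating_prob a 0 = weight a"
  by (simp add: letter_alternating_prob_def alternates_def prob_coord)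

text \<open>After \<open>a\<close> the word must go on with the other letter \<open>a + 1\<close>,
  and this tail is independent of the first letter.\<close>

lemma letter_alternating_prob_Suc:
  "letter_alternating_prob a (Suc n) = weight a * letter_alternating_prob (a + 1) n"
proof -
  let ?C = "{\<omega>. \<omega> 0 = a + 1 \<and> alternates n 0 \<omega>}"
  have C: "?C \<in> events"
    using sets.Int[OF coord_eq_set alternates_set] by (simp add: Collect_conj_eq)
  have neq: "x \<noteq> y \<longleftrightarrow> y = x + 1" for x y :: bit
    by (cases x; cases y) simp_all
  have "{\<omega>. \<omega> 0 = a \<and> alternates (Suc n) 0 \<omega>} = {\<omega>. \<omega> \<in> {\<omega>. \<omega> 0 = a} \<and> (\<lambda>i. \<omega> (i + 1)) \<in> ?C}"
    unfolding mem_Collect_eq alternates_Suc_front alternates_shift neq[of "_ 0"] One_nat_def add_0 by blast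
  moreover have "prob \<dots> = weight a * prob ?C"
    unfolding prob_coord[of 0, symmetric]
    by (rule prob_split[OF coord_eq_set C]) (simp add: determined_by_def)
  ultimately show ?thesis
    by (simp only: letter_alternating_prob_def)
qed

text \<open>Any two further letters are one 0 and one 1 and contribute the factor p (1 - p).\<close>

lemma letter_alternating_prob_even:
  "letter_alternating_prob a (2 * k) = weight a * (p * (1 - p)) ^ k"
proof (induction k)
  case (Suc k)
  have eq: "weight a * weight (a + 1) = p * (1 - p)" "a + 1 + 1 = a"
    by (cases a; simp add: weight_def)+
  have "letter_alternating_prob a (2 * Suc k) = weight a * (weight (a + 1) * letter_alternating_prob a (2 * k))"
    by (simp only: mult_Suc_right add_2_eq_Suc letter_alternating_prob_Suc eq(2))
  also have "\<dots> = (weight a * weight (a + 1)) * (weight a * (p * (1 - p)) ^ k)"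
    by (simp only: Suc mult.assoc)
  finally show ?case
    by (simp only: eq(1) power_Suc mult.left_commute)
qed (simp add: letter_alternating_prob_0)

lemma letter_alternating_prob_odd:
  "letter_alternating_prob a (Suc (2 * k)) = (p * (1 - p)) ^ Suc k"
proof -
  have "weight a * weight (a + 1) = p * (1 - p)"
    by (cases a; simp add: weight_def)
  then show ?thesis
    by (simp add: letter_alternating_prob_Suc letter_alternating_prob_even flip: mult.assoc)
qed

lemma prob_letter_cases:
  assumes "B \<in> events"
  shows "prob B = prob (B \<inter> {\<omega>. \<omega> i = 0}) + prob (B \<inter> {\<omega>. \<omega> i = 1})"
proof -
  have "B = (B \<inter> {\<omega>. \<omega> i = 0}) \<union> (B \<inter> {\<omega>. \<omega> i = 1})"
    using bit.exhaust by blast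
  moreover have "prob \<dots> = prob (B \<inter> {\<omega>. \<omega> i = 0}) + prob (B \<inter> {\<omega>. \<omega> i = 1})"
    by (rule finite_measure_Union) (use assms in auto)
  ultimately show ?thesis by simp
qed

lemma alternating_prob_eq_sum:
  "alternating_prob n = letter_alternating_prob 0 n + letter_alternating_prob 1 n"
  using prob_letter_cases[OF alternates_set, of n 0 0]
  unfolding alternating_prob_def letter_alternating_prob_def Collect_conj_eq
  by (simp only: Int_commute)

lemma alternating_prob_even: "alternating_prob (2 * k) = (p * (1 - p)) ^ k"
  by (simp add: alternating_prob_eq_sum letter_alternating_prob_even weight_def flip: distrib_right)

lemma alternating_prob_odd: "alternating_prob (Suc (2 * k)) = 2 * (p * (1 - p)) ^ Suc k"
  by (simp add: alternating_prob_eq_sum letter_alternating_prob_odd)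

section \<open>Probability that a clump ends\<close>

definition clump_end_prob :: "nat \<Rightarrow> real" where
  "clump_end_prob n = alternating_prob n - alternating_prob (Suc n)"

lemma prob_clump_end:
  "prob {\<omega>. alternates n 0 \<omega> \<and> \<omega> n = \<omega> (n + 1)} = clump_end_prob n"
proof -
  have "{\<omega>. alternates n 0 \<omega> \<and> \<omega> n = \<omega> (n + 1)} = {\<omega>. alternates n 0 \<omega>} - {\<omega>. alternates (Suc n) 0 \<omega>}"
    unfolding alternates_Suc add_0 by blast
  moreover have "prob \<dots> = prob {\<omega>. alternates n 0 \<omega>} - prob {\<omega>. alternates (Suc n) 0 \<omega>}"
  proof (rule finite_measure_Diff)
    show "{\<omega>. alternates (Suc n) 0 \<omega>} \<subseteq> {\<omega>. alternates n 0 \<omega>}"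
      unfolding alternates_Suc by blast
  qed (rule alternates_set)+
  ultimately show ?thesis
    by (simp only: clump_end_prob_def alternating_prob_def)
qed

text \<open>The factor is the extremal index of the visits, the fraction of visits that end their
  clump. It depends on the parity of the length, being 1/2 in the odd case below, and this is the
  source of the divergence.\<close>

lemma clump_end_prob_even: "clump_end_prob (2 * k) = (1 - 2 * (p * (1 - p))) * alternating_prob (2 * k)"
  unfolding clump_end_prob_def alternating_prob_even alternating_prob_odd
  by (simp add: algebra_simps)

lemma clump_end_prob_odd: "clump_end_prob (Suc (2 * k)) = 1/2 * alternating_prob (Suc (2 * k))"
  using alternating_prob_even[of "Suc k"]
  unfolding clump_end_prob_def alternating_prob_odd mult_Suc_right add_2_eq_Suc by simp

subsection \<open>Probability of no visit\<close>

text \<open>Positions are counted from 0, while \<open>visit_count\<close> starts at 1; by shift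
  invariance only the number of consecutive positions matters.\<close>

definition void_prob :: "nat \<Rightarrow> nat \<Rightarrow> real" where
  "void_prob n m = prob {\<omega>. \<forall>j<m. \<not> alternates n j \<omega>}"

lemma void_set: "{\<omega>. \<forall>j\<in>J. \<not> alternates n j \<omega>} \<in> events"
proof -
  have "{\<omega>. \<forall>j\<in>J. \<not> alternates n j \<omega>} = UNIV - (\<Union>j\<in>J. {\<omega>. alternates n j \<omega>})"
    by auto
  also have "\<dots> \<in> events"
    using sets.compl_sets[OF sets.countable_UN''[of J "\<lambda>j. {\<omega>. alternates n j \<omega>}" P]]
    by simp
  finally show ?thesis .
qed

lemma prob_void: "prob {\<omega>. \<forall>j\<in>{l..<m}. \<not> alternates n j \<omega>} = void_prob n (m - l)"
proof -
  have "(\<forall>j\<in>{l..<m}. \<not> alternates n j \<omega>) \<longleftrightarrow> (\<forall>j\<in>{..<m - l}. \<not> alternates n (j + l) \<omega>)" for \<omega>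
  proof (intro iffI ballI)
    fix j
    assume "\<forall>j\<in>{..<m - l}. \<not> alternates n (j + l) \<omega>" "j \<in> {l..<m}"
    then show "\<not> alternates n j \<omega>"
      by (auto dest!: bspec[of _ _ "j - l"])
  qed auto
  then show ?thesis
    using prob_shift[OF void_set[of "{..<m - l}" n], of l]
    by (simp add: alternates_shift void_prob_def Ball_def)
qed

lemma void_prob_0: "void_prob n 0 = 1"
  using prob_space by (simp add: void_prob_def)

lemma void_prob_bound: "0 \<le> void_prob n m" "void_prob n m \<le> 1"
  by (simp_all add: void_prob_def)

lemma void_prob_decseq: "l \<le> m \<Longrightarrow> void_prob n m \<le> void_prob n l"
  using void_set[of "{..<l}" n] unfolding void_prob_def
  by (intro finite_measure_mono) (auto simp: Ball_def)

text \<open>By shift invariance \<open>void_prob n m\<close> is also the probability of no visit at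
  1 to \<open>m\<close>. The added position can thus be put in front, at 0, and the two events are
  nested.\<close>

lemma void_prob_diff:
  "void_prob n m - void_prob n (Suc m) =
    prob {\<omega>. alternates n 0 \<omega> \<and> (\<forall>j\<in>{1..m}. \<not> alternates n j \<omega>)}"
proof -
  let ?V = "{\<omega>. \<forall>j\<in>{1..<Suc m}. \<not> alternates n j \<omega>}" and ?W = "{\<omega>. \<forall>j\<in>{0..<Suc m}. \<not> alternates n j \<omega>}"
  have "prob (?V - ?W) = prob ?V - prob ?W"
    by (rule finite_measure_Diff) (auto intro: void_set)
  moreover have "?V - ?W = {\<omega>. alternates n 0 \<omega> \<and> (\<forall>j\<in>{1..m}. \<not> alternates n j \<omega>)}"
  proof -
    have "{0..<Suc m} = insert 0 {1..m}" "{1..<Suc m} = {1..m}" by auto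
    then show ?thesis by auto
  qed
  ultimately show ?thesis
    unfolding prob_void by simp
qed

text \<open>Each added position removes at most the probability of a visit there.\<close>

lemma void_prob_diff_le: "void_prob n m - void_prob n (m + k) \<le> real k * alternating_prob n"
proof (induction k)
  case (Suc k)
  have "void_prob n (m + k) - void_prob n (Suc (m + k)) \<le> alternating_prob n"
    unfolding void_prob_diff alternating_prob_def by (intro finite_measure_mono) auto
  with Suc show ?case by (simp add: algebra_simps)
qed simp

text \<open>The occurrence at 0 that ends a clump is determined by the letters up to \<open>n + 1\<close>, so that
  occurrences from \<open>n + 2\<close> on are independent of it; an occurrence at \<open>n + 1\<close> is independent of
  the occurrence at 0 itself.\<close>

lemma void_prob_step:
  assumes "n \<ge> 1" "m \<ge> 1"
  shows "\<bar>void_prob n m - void_prob n (Suc m) - clump_end_prob n * void_prob n (m - Suc n)\<bar>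
    \<le> (alternating_prob n)\<^sup>2"
proof -
  let ?D = "{\<omega>. alternates n 0 \<omega> \<and> \<omega> n = \<omega> (n + 1)}"
  let ?E = "{\<omega>. alternates n 0 \<omega> \<and> (\<forall>j\<in>{1..m}. \<not> alternates n j \<omega>)}"
  let ?V = "{\<omega>. \<forall>j\<in>{n + 2..<Suc m}. \<not> alternates n j \<omega>}"
  let ?A = "\<lambda>k. {\<omega>. alternates n k \<omega>}"
  have D: "?D \<in> events"
  proof -
    have "?D = ?A 0 - {\<omega>. alternates (Suc n) 0 \<omega>}"
      unfolding alternates_Suc add_0 by blast
    also have "\<dots> \<in> events"
      by (intro sets.Diff alternates_set)
    finally show ?thesis .
  qed
  have E: "?E = ?A 0 \<inter> {\<omega>. \<omega> n = \<omega> (n + 1) \<and> (\<forall>j\<in>{n + 1..m}. \<not> alternates n j \<omega>)}"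
    using no_alternates_from_1[OF assms] by blast
  have E_set: "?E \<in> events"
    using sets.Int[OF alternates_set void_set] by (simp add: Collect_conj_eq)
  have "prob (?D \<inter> ?V) = prob ?D * prob ?V"
  proof (rule prob_indep[where m="n + 2"])
    show "determined_by {..<n + 2} ?D"
      unfolding determined_by_def mem_Collect_eq
    proof (intro allI impI)
      fix \<omega> \<omega>' :: binseq
      assume eq: "\<forall>i\<in>{..<n + 2}. \<omega> i = \<omega>' i"
      then have "alternates n 0 \<omega> \<longleftrightarrow> alternates n 0 \<omega>'"
        by (intro alternates_cong) auto
      moreover have "\<omega> n = \<omega>' n" "\<omega> (n + 1) = \<omega>' (n + 1)"
        using eq by simp_all
      ultimately show "(alternates n 0 \<omega> \<and> \<omega> n = \<omega> (n + 1)) = (alternates n 0 \<omega>' \<and> \<omega>' n = \<omega>' (n + 1))"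
        by simp
    qed
    show "determined_by {n + 2..} ?V"
      unfolding determined_by_def
    proof (intro allI impI)
      fix \<omega> \<omega>' :: binseq
      assume "\<forall>i\<in>{n + 2..}. \<omega> i = \<omega>' i"
      then have "alternates n j \<omega> \<longleftrightarrow> alternates n j \<omega>'" if "n + 2 \<le> j" for j
        using that by (intro alternates_cong) auto
      then show "\<omega> \<in> ?V \<longleftrightarrow> \<omega>' \<in> ?V" by auto
    qed
  qed (use D void_set in auto)
  then have DV: "prob (?D \<inter> ?V) = clump_end_prob n * void_prob n (m - Suc n)"
    unfolding prob_clump_end prob_void by simp
  \<comment> \<open>The words at 0 and at \<open>n + 1\<close> occupy 0 to \<open>n\<close> and
    \<open>n + 1\<close> to \<open>2 * n + 1\<close>, which are disjoint.\<close>
  have "prob (?A 0 \<inter> ?A (n + 1)) = prob (?A 0) * prob (?A (n + 1))"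
  proof (rule prob_indep[where m="n + 1"])
    show "determined_by {..<n + 1} (?A 0)" "determined_by {n + 1..} (?A (n + 1))"
      unfolding determined_by_def mem_Collect_eq by (auto intro!: alternates_cong)
  qed simp_all
  then have AA: "prob (?A 0 \<inter> ?A (n + 1)) = (alternating_prob n)\<^sup>2"
    by (simp only: prob_alternates power2_eq_square)
  have events: "?D \<inter> ?V \<in> events" "?A 0 \<inter> ?A (n + 1) \<in> events"
    by (intro sets.Int D void_set alternates_set)+
  have "?E \<subseteq> ?D \<inter> ?V"
    unfolding E by auto
  then have "prob ?E \<le> prob (?D \<inter> ?V)"
    by (rule finite_measure_mono[OF _ events(1)])
  \<comment> \<open>Only position \<open>n + 1\<close> is tested by \<open>?E\<close> and not by
    \<open>?V\<close>, so a sequence lost here has visits at both 0 and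
    \<open>n + 1\<close>.\<close>
  moreover have "?D \<inter> ?V \<subseteq> ?E \<union> (?A 0 \<inter> ?A (n + 1))"
  proof -
    have "{n + 1..m} \<subseteq> insert (n + 1) {n + 2..<Suc m}" by auto
    then show ?thesis unfolding E by blast
  qed
  then have "prob (?D \<inter> ?V) \<le> prob ?E + prob (?A 0 \<inter> ?A (n + 1))"
    by (rule order_trans[OF finite_measure_mono[OF _ sets.Un[OF E_set events(2)]]
          measure_Un_le[OF E_set events(2)]])
  ultimately show ?thesis
    unfolding void_prob_diff DV AA by simp
qed

text \<open>Let d be \<open>clump_end_prob n\<close> and a be \<open>alternating_prob n\<close>.
  Replacing \<open>void_prob n (m - Suc n)\<close> by \<open>void_prob n m\<close> in
  \<open>void_prob_step\<close> gives a recursion with factor 1 - d and error at most d (n + 3) a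
  per step. Since (n + 3) a is fixed by e \<mapsto> (1 - d) e + d (n + 3) a, errors do not
  accumulate and the bound is uniform in \<open>m\<close>.\<close>

lemma void_prob_approx:
  assumes "n \<ge> 1" and clump: "alternating_prob n \<le> 2 * clump_end_prob n"
  shows "\<bar>void_prob n m - (1 - clump_end_prob n) ^ m\<bar> \<le> (real n + 3) * alternating_prob n"
proof (induction m)
  case 0
  then show ?case by (simp add: void_prob_0 alternating_prob_def)
next
  case (Suc m)
  let ?a = "alternating_prob n" and ?d = "clump_end_prob n" and ?v = "void_prob n"
  have a: "0 \<le> ?a" "?a \<le> 1" and "0 \<le> alternating_prob (Suc n)"
    by (simp_all add: alternating_prob_def)
  then have d: "0 \<le> ?d" "?d \<le> ?a"
    using clump by (auto simp: clump_end_prob_def)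
  show ?case
  proof (cases "m = 0")
    \<comment> \<open>\<open>void_prob_step\<close> starts at \<open>m = 1\<close>, so the first
      step is done directly: both values lie between 1 - a and 1.\<close>
    case True
    have "?v 1 \<ge> 1 - ?a" "?v 1 \<le> 1"
      using void_prob_diff_le[of n 0 1] void_prob_bound[of n 1] by (auto simp: void_prob_0)
    then have "\<bar>?v 1 - (1 - ?d)\<bar> \<le> 1 * ?a"
      using d by (simp add: abs_le_iff)
    also have "\<dots> \<le> (real n + 3) * ?a"
      using a by (intro mult_right_mono) auto
    finally show ?thesis
      using True by simp
  next
    case False
    \<comment> \<open>Truncated subtraction: \<open>k\<close> is 0 for \<open>m \<le> n\<close>, and
      \<open>m - k \<le> Suc n\<close> in either case.\<close>
    define k where "k = m - Suc n"
    have step: "\<bar>?v m - ?v (Suc m) - ?d * ?v k\<bar> \<le> ?a\<^sup>2"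
      using void_prob_step[of n m] assms False by (simp add: k_def)
    have k: "k \<le> m" "m - k \<le> Suc n"
      by (auto simp: k_def)
    have "?v k - ?v m \<le> real (m - k) * ?a"
      using void_prob_diff_le[of n k "m - k"] k by simp
    also have "\<dots> \<le> real (Suc n) * ?a"
      using k a by (intro mult_right_mono) auto
    finally have "?d * (?v k - ?v m) \<le> ?d * (real (Suc n) * ?a)"
      using d by (intro mult_left_mono) auto
    moreover have "0 \<le> ?d * (?v k - ?v m)"
      using d void_prob_decseq[OF k(1), of n] by simp
    \<comment> \<open>\<open>clump\<close> makes the quadratic error a multiple of d; its 2 and the
      n + 1 from the changed argument add up to n + 3.\<close>
    moreover have "?a\<^sup>2 \<le> ?d * (2 * ?a)"
      using mult_right_mono[OF clump a(1)] by (simp add: power2_eq_square mult.commute mult.left_commute)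
    ultimately have "\<bar>?v (Suc m) - (1 - ?d) * ?v m\<bar> \<le> ?d * ((real n + 3) * ?a)"
      using step by (simp add: algebra_simps abs_le_iff)
    moreover have "\<bar>(1 - ?d) * (?v m - (1 - ?d) ^ m)\<bar> \<le> (1 - ?d) * ((real n + 3) * ?a)"
      using Suc a d by (simp add: abs_mult mult_left_mono)
    moreover have "?v (Suc m) - (1 - ?d) ^ Suc m =
        (?v (Suc m) - (1 - ?d) * ?v m) + (1 - ?d) * (?v m - (1 - ?d) ^ m)"
      by (simp add: algebra_simps)
    ultimately have "\<bar>?v (Suc m) - (1 - ?d) ^ Suc m\<bar> \<le>
        ?d * ((real n + 3) * ?a) + (1 - ?d) * ((real n + 3) * ?a)"
      by linarith
    also have "\<dots> = (real n + 3) * ?a"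
      unfolding distrib_right[symmetric] by simp
    finally show ?thesis .
  qed
qed

section \<open>Limits of the void probabilities along even and odd lengths\<close>

text \<open>Under \<open>lim\<close> the error in \<open>void_prob_approx\<close> vanishes, and what
  remains is the classical limit of (1 - c a)^N with N the integral part of t / a. The bound
  \<open>c \<ge> 1/2\<close> gives the clump condition of that estimate.\<close>

lemma void_prob_tendsto:
  fixes r :: "nat \<Rightarrow> nat" and c t :: real
  assumes r: "\<And>k. r k \<ge> 1" and c: "c \<ge> 1/2" and t: "t > 0"
    and clump: "\<And>k. clump_end_prob (r k) = c * alternating_prob (r k)"
    and pos: "\<And>k. alternating_prob (r k) > 0"
    and lim: "(\<lambda>k. (real (r k) + 3) * alternating_prob (r k)) \<longlonglongrightarrow> 0"
  shows "(\<lambda>k. void_prob (r k) (nat \<lfloor>t / alternating_prob (r k)\<rfloor>)) \<longlonglongrightarrow> exp (- c * t)"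
proof -
  let ?a = "\<lambda>k. alternating_prob (r k)" and ?N = "\<lambda>k. nat \<lfloor>t / alternating_prob (r k)\<rfloor>"
  have a_le: "?a k \<le> (real (r k) + 3) * ?a k" for k
    using mult_right_mono[of 1 "real (r k) + 3" "?a k"] less_imp_le[OF pos[of k]] by linarith
  have "?a \<longlonglongrightarrow> 0"
    by (rule tendsto_sandwich[OF _ _ tendsto_const lim])
       (intro always_eventually allI less_imp_le[OF pos] a_le)+
  then have a_right: "filterlim ?a (at_right 0) sequentially"
    by (intro tendsto_imp_filterlim_at_right always_eventually allI pos)
  \<comment> \<open>Writing the power with \<open>powr\<close> gives a limit in one real variable;
    it equals the natural power once 1 - c a > 0, which holds eventually.\<close>
  have "((\<lambda>x. (1 - c * x) powr of_int \<lfloor>t / x\<rfloor>) \<longlongrightarrow> exp (- c * t)) (at_right 0)"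
    using t c by real_asymp
  from filterlim_compose[OF this a_right]
  have "(\<lambda>k. (1 - c * ?a k) powr of_int \<lfloor>t / ?a k\<rfloor>) \<longlonglongrightarrow> exp (- c * t)" .
  moreover have "\<forall>\<^sub>F k in sequentially. (1 - c * ?a k) powr of_int \<lfloor>t / ?a k\<rfloor> = (1 - clump_end_prob (r k)) ^ ?N k"
  proof -
    have "\<forall>\<^sub>F k in sequentially. ?a k < 1 / c"
      using c by (intro order_tendstoD[OF \<open>?a \<longlonglongrightarrow> 0\<close>]) auto
    then show ?thesis
    proof eventually_elim
      case (elim k)
      then have "1 - c * ?a k > 0"
        using c by (simp add: field_simps)
      moreover have "of_int \<lfloor>t / ?a k\<rfloor> = real (?N k)"
        using t pos[of k] by simp
      ultimately show ?case
        by (simp only: clump powr_realpow)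
    qed
  qed
  ultimately have main: "(\<lambda>k. (1 - clump_end_prob (r k)) ^ ?N k) \<longlonglongrightarrow> exp (- c * t)"
    by (rule Lim_transform_eventually)
  have "alternating_prob (r k) \<le> 2 * clump_end_prob (r k)" for k
    using mult_right_mono[OF c less_imp_le[OF pos[of k]]] by (simp add: clump)
  from void_prob_approx[OF r this]
  have "(\<lambda>k. void_prob (r k) (?N k) - (1 - clump_end_prob (r k)) ^ ?N k) \<longlonglongrightarrow> 0"
    by (intro Lim_null_comparison[OF _ lim]) auto
  from tendsto_add[OF this main] show ?thesis
    by simp
qed

lemma pq_bounds: "0 < p * (1 - p)" "p * (1 - p) < 1" "p * (1 - p) \<le> 1/4"
proof -
  have "0 \<le> (p - 1/2)\<^sup>2" by simp
  then show "p * (1 - p) \<le> 1/4"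
    by (simp add: power2_eq_square algebra_simps)
  then show "p * (1 - p) < 1" by simp
qed (use p in simp)

text \<open>\<open>Suc k\<close> keeps the length positive, as \<open>void_prob_tendsto\<close>
  demands.\<close>

lemma void_prob_tendsto_even:
  assumes "t > 0"
  shows "(\<lambda>k. void_prob (2 * Suc k) (nat \<lfloor>t / alternating_prob (2 * Suc k)\<rfloor>))
    \<longlonglongrightarrow> exp (- (1 - 2 * (p * (1 - p))) * t)"
proof (rule void_prob_tendsto)
  define q where "q = p * (1 - p)"
  have "0 < q" "q < 1" using pq_bounds by (auto simp: q_def)
  then have "(\<lambda>k. (real (2 * Suc k) + 3) * q ^ Suc k) \<longlonglongrightarrow> 0"
    by real_asymp
  then show "(\<lambda>k. (real (2 * Suc k) + 3) * alternating_prob (2 * Suc k)) \<longlonglongrightarrow> 0"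
    unfolding alternating_prob_even q_def .
  show "alternating_prob (2 * Suc k) > 0" for k
    unfolding alternating_prob_even using pq_bounds(1) by (rule zero_less_power)
  show "clump_end_prob (2 * Suc k) = (1 - 2 * (p * (1 - p))) * alternating_prob (2 * Suc k)" for k
    by (rule clump_end_prob_even)
  show "1 / 2 \<le> 1 - 2 * (p * (1 - p))"
    using pq_bounds(3) by linarith
  show "t > 0" by (fact assms)
qed simp

lemma void_prob_tendsto_odd:
  assumes "t > 0"
  shows "(\<lambda>k. void_prob (Suc (2 * k)) (nat \<lfloor>t / alternating_prob (Suc (2 * k))\<rfloor>))
    \<longlonglongrightarrow> exp (- (1/2) * t)"
proof (rule void_prob_tendsto)
  define q where "q = p * (1 - p)"
  have "0 < q" "q < 1" using pq_bounds by (auto simp: q_def)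
  then have "(\<lambda>k. (real (Suc (2 * k)) + 3) * (2 * q ^ Suc k)) \<longlonglongrightarrow> 0"
    by real_asymp
  then show "(\<lambda>k. (real (Suc (2 * k)) + 3) * alternating_prob (Suc (2 * k))) \<longlonglongrightarrow> 0"
    unfolding alternating_prob_odd q_def .
  show "alternating_prob (Suc (2 * k)) > 0" for k
    unfolding alternating_prob_odd using zero_less_power[OF pq_bounds(1), of "Suc k"] by simp
  show "clump_end_prob (Suc (2 * k)) = 1/2 * alternating_prob (Suc (2 * k))" for k
    by (rule clump_end_prob_odd)
  show "t > 0" by (fact assms)
qed simp_all

subsection \<open>Mixing of the image measure\<close>

lemma measurable_xor_map: "xor_map \<in> measurable P P"
proof (rule measurable_to_P)
  fix i a
  have 1: "{\<omega>. xor_map \<omega> i = 1} = {\<omega>. alternates 1 i \<omega>}"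
    by (simp only: xor_map_def alternates_def bit_add_eq_1_iff less_one all_simps simp_thms add_0_right)
  show "{\<omega> \<in> space P. xor_map \<omega> i = a} \<in> events"
  proof (cases a)
    case zero
    have "{\<omega> \<in> space P. xor_map \<omega> i = a} = space P - {\<omega>. xor_map \<omega> i = 1}"
      using zero by auto
    then show ?thesis
      unfolding 1 by (simp only: sets.compl_sets alternates_set)
  next
    case one
    then show ?thesis
      using alternates_set[of 1 i] 1 by simp
  qed
qed

abbreviation "Q \<equiv> image_measure p"

lemma sets_image [simp]: "sets Q = events"
  by (simp add: image_measure_def)

lemma space_image [simp]: "space Q = UNIV"
  by (simp add: image_measure_def)

lemma xor_map_events: "B \<in> events \<Longrightarrow> xor_map -` B \<in> events"
  using measurable_sets[OF measurable_xor_map, of B] by simp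

lemma measure_image: "B \<in> events \<Longrightarrow> measure Q B = prob (xor_map -` B)"
  unfolding image_measure_def by (simp add: measure_distr[OF measurable_xor_map])

lemma left_shift_eq: "left_shift = (\<lambda>\<omega> i. \<omega> (i + 1))"
  by (simp add: left_shift_def fun_eq_iff)

lemma measurable_left_shift: "left_shift \<in> measurable P P"
  unfolding left_shift_eq by (rule measurable_shift)

lemma distr_left_shift: "distr P P left_shift = P"
proof (rule measure_eqI)
  fix B assume "B \<in> sets (distr P P left_shift)"
  then have B: "B \<in> events" by simp
  have "emeasure (distr P P left_shift) B = emeasure P {\<omega>. left_shift \<omega> \<in> B}"
    using B by (simp add: emeasure_distr[OF measurable_left_shift] vimage_def)
  also have "\<dots> = emeasure P B"
    using prob_shift[OF B, of 1] unfolding left_shift_eq by (simp add: emeasure_eq_measure)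
  finally show "emeasure (distr P P left_shift) B = emeasure P B" .
qed simp

lemma measurable_left_shift_image: "left_shift \<in> measurable Q Q"
  using measurable_left_shift by (simp cong: measurable_cong_sets)

text \<open>\<open>xor_map\<close> commutes with the shift, and \<open>P\<close> is shift
  invariant.\<close>

lemma image_invariant: "distr Q Q left_shift = Q"
proof -
  have "distr Q Q left_shift = distr Q P left_shift"
    by (rule distr_cong) simp_all
  also have "\<dots> = distr P P (left_shift \<circ> xor_map)"
    unfolding image_measure_def by (rule distr_distr[OF measurable_left_shift measurable_xor_map])
  also have "left_shift \<circ> xor_map = xor_map \<circ> left_shift"
    by (simp add: fun_eq_iff left_shift_def xor_map_def)
  also have "distr P P (xor_map \<circ> left_shift) = distr (distr P P left_shift) P xor_map"
    by (rule distr_distr[OF measurable_xor_map measurable_left_shift, symmetric])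
  finally show ?thesis
    by (simp only: distr_left_shift image_measure_def)
qed

lemma coord_algebra_events:
  assumes "B \<in> coord_algebra k n"
  shows "B \<in> events"
proof -
  have "{(\<lambda>\<omega>. \<omega> i) -` A | i A. k \<le> i \<and> enat i \<le> n} \<subseteq> events"
    using coord_set by (auto simp: vimage_def)
  from sets.sigma_sets_subset[OF this] assms show ?thesis
    by (auto simp: coord_algebra_def)
qed

lemma UNIV_coord_algebra: "UNIV \<in> coord_algebra k n"
  unfolding coord_algebra_def by (rule sigma_sets_top)

text \<open>In the i.i.d. sequence the past reads the letters up to \<open>n + 1\<close> and the
  future those from \<open>n + m + 1\<close> on. The ranges share the single letter
  \<open>n + 1\<close> if \<open>m = 0\<close> and are disjoint otherwise.\<close>

lemma past_future_images:
  assumes B: "B \<in> coord_algebra 0 (enat n)" and C: "C \<in> coord_algebra (n + m + 1) \<infinity>"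
  defines "B' \<equiv> xor_map -` B" and "C' \<equiv> xor_map -` C"
  shows "B' \<in> events" "C' \<in> events" "determined_by {..<n + 2} B'" "determined_by {n + m + 1..} C'"
    "measure Q B = prob B'" "measure Q C = prob C'" "measure Q (B \<inter> C) = prob (B' \<inter> C')"
proof -
  note ev = coord_algebra_events[OF B] coord_algebra_events[OF C]
  show "B' \<in> events" "C' \<in> events"
    using ev by (auto simp: B'_def C'_def intro: xor_map_events)
  show "determined_by {..<n + 2} B'"
    unfolding B'_def
    by (rule determined_by_mono[OF determined_by_xor_map[OF determined_by_coord_algebra[OF B]]]) auto
  show "determined_by {n + m + 1..} C'"
    unfolding C'_def
    by (rule determined_by_mono[OF determined_by_xor_map[OF determined_by_coord_algebra[OF C]]]) auto
  show "measure Q B = prob B'" "measure Q C = prob C'" "measure Q (B \<inter> C) = prob (B' \<inter> C')"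
    using ev by (auto simp: B'_def C'_def measure_image vimage_Int)
qed

text \<open>Once the shared letter is frozen to \<open>a\<close>, the event \<open>C\<close> becomes
  \<open>?C\<close>, which is independent of \<open>B\<close> and of that letter. Independence of
  the letter bounds \<open>prob ?C\<close> by \<open>prob C / weight a\<close>.\<close>

lemma prob_common_letter_le:
  assumes B: "B \<in> events" "determined_by {..<m + 1} B" and C: "C \<in> events" "determined_by {m..} C"
  shows "prob (B \<inter> C \<inter> {\<omega>. \<omega> m = a}) \<le> prob B * prob C / weight a"
proof -
  let ?C = "{\<omega>. fun_upd \<omega> m a \<in> C}" and ?L = "{\<omega>. \<omega> m = a}"
  have "(\<lambda>\<omega>. fun_upd \<omega> m a) \<in> measurable P P"
  proof (rule measurable_to_P)
    show "{\<omega> \<in> space P. fun_upd \<omega> m a i = b} \<in> events" for i b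
      using sets.top[of P] by (cases "i = m"; cases "a = b") simp_all
  qed
  from measurable_sets[OF this C(1)] have Ca: "?C \<in> events"
    by (simp add: vimage_def)
  have det: "determined_by {m + 1..} ?C"
    unfolding determined_by_def mem_Collect_eq
    by (intro allI impI determined_byD[OF C(2)]) auto
  have L: "determined_by {..<m + 1} ?L"
    by (simp add: determined_by_def)
  have upd: "\<omega> \<in> ?C \<longleftrightarrow> \<omega> \<in> C" if "\<omega> \<in> ?L" for \<omega>
    using that by (simp add: fun_upd_idem)
  have "weight a * prob ?C = prob (?L \<inter> ?C)"
    using prob_indep[OF coord_eq_set Ca L det] by (simp only: prob_coord)
  also have "\<dots> \<le> prob C"
    using upd C(1) by (intro finite_measure_mono) blast+
  finally have Cle: "prob ?C \<le> prob C / weight a"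
    using weight_pos[of a] by (simp add: field_simps)
  have "prob (B \<inter> C \<inter> ?L) \<le> prob (B \<inter> ?C)"
  proof (rule finite_measure_mono)
    show "B \<inter> C \<inter> ?L \<subseteq> B \<inter> ?C" using upd by blast
  qed (rule sets.Int[OF B(1) Ca])
  also have "\<dots> = prob B * prob ?C"
    by (rule prob_indep[OF B(1) Ca B(2) det])
  also have "\<dots> \<le> prob B * (prob C / weight a)"
    using Cle by (rule mult_left_mono) simp
  finally show ?thesis by simp
qed

lemma psi_mixing_0: "psi_mixing Q 0 < \<infinity>"
proof -
  \<comment> \<open>One term for each value of the letter \<open>n + 1\<close> shared by past and
    future.\<close>
  define K where "K = 1 / weight 0 + 1 / weight 1"
  have K: "K \<ge> 0"
    using weight_pos[of 0] weight_pos[of 1] by (simp add: K_def)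
  have "\<bar>measure Q (B \<inter> C) / (measure Q B * measure Q C) - 1\<bar> \<le> K + 1"
    if B: "B \<in> coord_algebra 0 (enat n)" and C: "C \<in> coord_algebra (n + 0 + 1) \<infinity>"
      and nz: "measure Q B * measure Q C \<noteq> 0" for n B C
  proof -
    note im = past_future_images[OF B C]
    let ?B = "xor_map -` B" and ?C = "xor_map -` C"
    have det: "determined_by {..<n + 1 + 1} ?B" "determined_by {n + 1..} ?C"
      using im(3,4) by simp_all
    have "prob (?B \<inter> ?C) \<le> prob ?B * prob ?C / weight 0 + prob ?B * prob ?C / weight 1"
      unfolding prob_letter_cases[OF sets.Int[OF im(1,2)], of "n + 1"]
      by (intro add_mono prob_common_letter_le im(1,2) det)
    then have "measure Q (B \<inter> C) \<le> K * (measure Q B * measure Q C)"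
      unfolding im(5-7) K_def by (simp add: algebra_simps)
    moreover have "measure Q B * measure Q C > 0"
      using nz by (simp add: less_le)
    ultimately have "measure Q (B \<inter> C) / (measure Q B * measure Q C) \<le> K"
      by (simp add: divide_le_eq)
    moreover have "0 \<le> measure Q (B \<inter> C) / (measure Q B * measure Q C)"
      by simp
    ultimately show ?thesis
      using K by linarith
  qed
  then have "psi_mixing Q 0 \<le> ereal (K + 1)"
    unfolding psi_mixing_def by (intro SUP_least Sup_least) auto
  then show ?thesis
    by (rule le_less_trans) simp
qed

text \<open>Past and future read disjoint sets of i.i.d. letters, so every quotient equals
  1.\<close>

lemma psi_mixing_pos:
  assumes "l \<ge> 1"
  shows "psi_mixing Q l = 0"
proof -
  have "{ereal \<bar>measure Q (B \<inter> C) / (measure Q B * measure Q C) - 1\<bar> | B C.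
      B \<in> coord_algebra 0 (enat n) \<and> C \<in> coord_algebra (n + l + 1) \<infinity> \<and>
      measure Q B * measure Q C \<noteq> 0} = {0}" (is "?X = _") for n
  proof -
    have zero: "\<bar>measure Q (B \<inter> C) / (measure Q B * measure Q C) - 1\<bar> = 0"
      if B: "B \<in> coord_algebra 0 (enat n)" and C: "C \<in> coord_algebra (n + l + 1) \<infinity>"
        and nz: "measure Q B * measure Q C \<noteq> 0" for B C
    proof -
      note im = past_future_images[OF B C]
      have "determined_by {n + 2..} (xor_map -` C)"
        by (rule determined_by_mono[OF im(4)]) (use assms in auto)
      from prob_indep[OF im(1,2,3) this] nz show ?thesis
        unfolding im(5-7) by simp
    qed
    \<comment> \<open>The pair of full events shows that the set is nonempty; in
      \<open>ereal\<close> the supremum of the empty set would be -\<infinity>.\<close>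
    have "measure Q UNIV = 1"
      using measure_image[of UNIV] prob_space sets.top[of P] by simp
    then have "ereal \<bar>measure Q (UNIV \<inter> UNIV) / (measure Q UNIV * measure Q UNIV) - 1\<bar> \<in> ?X"
      using UNIV_coord_algebra by fastforce
    then have "0 \<in> ?X"
      using \<open>measure Q UNIV = 1\<close> by simp
    moreover have "y = 0" if "y \<in> ?X" for y
    proof -
      from that obtain B C where B: "B \<in> coord_algebra 0 (enat n)"
        and C: "C \<in> coord_algebra (n + l + 1) \<infinity>" and nz: "measure Q B * measure Q C \<noteq> 0"
        and y: "y = ereal \<bar>measure Q (B \<inter> C) / (measure Q B * measure Q C) - 1\<bar>"
        by blast
      show ?thesis
        unfolding y zero[OF B C nz] zero_ereal_def ..
    qed
    ultimately show ?thesis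
      by blast
  qed
  then show ?thesis
    unfolding psi_mixing_def by simp
qed

subsection \<open>Distribution of the visit count\<close>

lemma ones_cylinder_events: "ones_cylinder n \<in> events"
proof -
  have "ones_cylinder n = space P - (\<Union>i\<in>{..<n}. space P - {\<omega>. \<omega> i = 1})"
    by (auto simp: ones_cylinder_def)
  also have "\<dots> \<in> events"
    by (intro sets.Diff sets.top sets.finite_UN coord_eq_set) simp
  finally show ?thesis .
qed

lemma visit_horizon_image: "visit_horizon Q t n = nat \<lfloor>t / alternating_prob n\<rfloor>"
  by (simp add: visit_horizon_def measure_image[OF ones_cylinder_events] vimage_ones_cylinder
      alternating_prob_def divide_inverse)

lemma visit_count_measurable: "visit_count Q t n \<in> borel_measurable Q"
proof -
  have "(\<lambda>\<omega>. \<Sum>k = 1..visit_horizon Q t n. indicator (ones_cylinder n) ((left_shift ^^ k) \<omega>) :: real)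
      \<in> borel_measurable P"
  proof (rule borel_measurable_sum)
    show "(\<lambda>\<omega>. indicator (ones_cylinder n) ((left_shift ^^ k) \<omega>) :: real) \<in> borel_measurable P" for k
      unfolding funpow_left_shift
      by (rule measurable_compose[OF measurable_shift borel_measurable_indicator[OF ones_cylinder_events]])
  qed
  then show ?thesis
    by (simp add: visit_count_def[abs_def] cong: measurable_cong_sets)
qed

text \<open>The count is a natural number, so on [0, 1) its distribution function is constantly the
  probability of no visit.\<close>

lemma cdf_visit_count:
  assumes "0 \<le> x" "x < 1"
  shows "cdf (distr Q borel (visit_count Q t n)) x = void_prob n (nat \<lfloor>t / alternating_prob n\<rfloor>)"
proof -
  let ?N = "visit_horizon Q t n"
  have S: "visit_count Q t n -` {..x} \<in> events"
    using measurable_sets[OF visit_count_measurable, of "{..x}" t n] by simp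
  have "cdf (distr Q borel (visit_count Q t n)) x = measure Q (visit_count Q t n -` {..x})"
    by (simp add: cdf_def measure_distr[OF visit_count_measurable])
  also have "\<dots> = prob (xor_map -` visit_count Q t n -` {..x})"
    by (rule measure_image[OF S])
  also have "xor_map -` visit_count Q t n -` {..x} = {\<omega>. \<forall>j\<in>{1..<Suc ?N}. \<not> alternates n j \<omega>}"
  proof -
    have "visit_count Q t n (xor_map \<omega>) \<le> x \<longleftrightarrow> {k \<in> {1..?N}. alternates n k \<omega>} = {}" for \<omega>
    proof -
      have "real c \<le> x \<longleftrightarrow> c = 0" for c :: nat
        using assms by (cases c) auto
      then show ?thesis
        unfolding visit_count_xor by simp
    qed
    then show ?thesis
      by (auto simp: atLeastLessThanSuc_atLeastAtMost)
  qed
  also have "prob \<dots> = void_prob n ?N"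
    unfolding prob_void by simp
  finally show ?thesis
    unfolding visit_horizon_image .
qed

lemma visit_count_diverges:
  assumes "t > 0" "p \<noteq> 1/2"
  shows "\<not> converges_in_distribution Q (visit_count Q t)"
proof
  assume "converges_in_distribution Q (visit_count Q t)"
  then obtain \<mu> where "real_distribution \<mu>"
    and conv: "weak_conv_m (\<lambda>n. distr Q borel (visit_count Q t n)) \<mu>"
    by (auto simp: converges_in_distribution_def)
  interpret \<mu>: real_distribution \<mu> by fact
  \<comment> \<open>Weak convergence speaks only of continuity points of the limit; a monotone
    function has countably many discontinuities, so (0, 1) contains a continuity point.\<close>
  have "countable {x. \<not> isCont (cdf \<mu>) x}"
    by (rule mono_ctble_discont) (auto simp: mono_def intro: \<mu>.cdf_nondecreasing)
  moreover have "uncountable {0<..<1::real}"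
    by (simp add: uncountable_open_interval)
  ultimately obtain x where x: "0 < x" "x < 1" "isCont (cdf \<mu>) x"
    by (metis (mono_tags, lifting) countable_subset greaterThanLessThan_iff mem_Collect_eq subsetI)
  define v where "v = (\<lambda>n. void_prob n (nat \<lfloor>t / alternating_prob n\<rfloor>))"
  have "(\<lambda>n. cdf (distr Q borel (visit_count Q t n)) x) \<longlonglongrightarrow> cdf \<mu> x"
    using conv x(3) by (simp add: weak_conv_m_def weak_conv_def)
  then have v: "v \<longlonglongrightarrow> cdf \<mu> x"
    unfolding cdf_visit_count[OF less_imp_le[OF x(1)] x(2)] v_def .
  have "(v \<circ> (\<lambda>k. 2 * Suc k)) \<longlonglongrightarrow> cdf \<mu> x" "(v \<circ> (\<lambda>k. Suc (2 * k))) \<longlonglongrightarrow> cdf \<mu> x"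
    by (intro LIMSEQ_subseq_LIMSEQ[OF v]; simp add: strict_mono_def)+
  moreover have "(v \<circ> (\<lambda>k. 2 * Suc k)) \<longlonglongrightarrow> exp (- (1 - 2 * (p * (1 - p))) * t)"
    "(v \<circ> (\<lambda>k. Suc (2 * k))) \<longlonglongrightarrow> exp (- (1/2) * t)"
    unfolding v_def comp_def by (fact void_prob_tendsto_even[OF assms(1)] void_prob_tendsto_odd[OF assms(1)])+
  ultimately have "exp (- (1 - 2 * (p * (1 - p))) * t) = exp (- (1/2) * t)"
    using LIMSEQ_unique by metis
  then have "- (1 - 2 * (p * (1 - p))) * t = - (1/2) * t"
    by (simp only: exp_inj_iff)
  then have "- (1 - 2 * (p * (1 - p))) = - (1/2)"
    using assms(1) by (simp only: mult_cancel_right) simp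
  \<comment> \<open>Equal exponents mean p (1 - p) = 1/4, which has the double root p = 1/2.\<close>
  then have "(p - 1/2)\<^sup>2 = 0"
    by (simp add: power2_eq_square algebra_simps)
  then show False
    using assms(2) by simp
qed

end

theorem mainTheorem9:
  fixes p0 p1 :: real
  assumes "p0 > 0" and "p1 > 0" and "p0 + p1 = 1" and "p0 \<noteq> p1"
  shows "left_shift \<in> measurable (image_measure p1) (image_measure p1)
    \<and> distr (image_measure p1) (image_measure p1) left_shift = image_measure p1
    \<and> psi_mixing (image_measure p1) 0 < \<infinity>
    \<and> (\<forall>l\<ge>1. psi_mixing (image_measure p1) l = 0)
    \<and> (\<forall>t>0. \<not> converges_in_distribution (image_measure p1)
                  (visit_count (image_measure p1) t))"
proof -
  interpret coin p1
    by unfold_locales (use assms in auto)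
  have "p1 \<noteq> 1/2"
    using assms by auto
  then show ?thesis
    using measurable_left_shift_image image_invariant psi_mixing_0 psi_mixing_pos visit_count_diverges
    by blast
qed

end
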